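(* Let $A=B+\mathrm{i}C$ be an $n\times n$ generalized Higham matrix, i.e. $B=B^{*}>0$ and $C=C^{*}>0$ are $n\times n$ Hermitian positive definite matrices, and let $\rho_n(A)$ be the growth factor of $A$ in Gaussian elimination without pivoting. Then $$0\le \rho_n(A)\le 2.$$
   Context: $\mathrm{i}=\sqrt{-1}$, and $B^{*}$ is the conjugate transpose of $B$. For Hermitian matrices, $B>0$ means that $B$ is positive definite. A complex $n\times n$ matrix $A$ is a generalized Higham matrix if in its Toeplitz (Hermitian) decomposition $A=B+\mathrm{i}C$ with $B=B^{*}$, $C=C^{*}$, both $B$ and $C$ are positive definite. (Higham matrices are the special case in which $B$ and $C$ are moreover real symmetric.) The growth factor of $A=(a_{ij})$ in Gaussian elimination without pivoting is $$\rho_n(A)=\frac{\max_{i,j,k}|a^{(k)}_{ij}|}{\max_{i,j}|a_{ij}|},$$ where $A^{(k)}=(a^{(k)}_{ij})$ is the $n\times n$ matrix obtained by applying the first $k$ steps of Gaussian elimination (without row or column interchanges) to $A$; here $1\le i,j\le n$ and $0\le k\le n-1$, with $A^{(0)}=A$, and $A^{(n-1)}$ is the upper triangular factor in the $LU$ factorization of $A$. *)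

theory Defs
  imports "Jordan_Normal_Form.Schur_Decomposition"
begin

definition hermitian_mat :: "complex mat \<Rightarrow> bool" where
  "hermitian_mat B \<longleftrightarrow> square_mat B \<and> mat_adjoint B = B"

text \<open>Since \<open>u \<bullet>c v\<close> conjugates its second argument, the product below is \<open>x\<^sup>* B x\<close>.
  In the order of \<^theory>\<open>HOL-Library.Complex_Order\<close>, \<open>0 < z\<close> means that \<open>z\<close> is real and
  positive.\<close>

definition pos_def_mat :: "complex mat \<Rightarrow> bool" where
  "pos_def_mat B \<longleftrightarrow> hermitian_mat B \<and>
     (\<forall>x \<in> carrier_vec (dim_row B). x \<noteq> 0\<^sub>v (dim_row B) \<longrightarrow> 0 < (B *\<^sub>v x) \<bullet>c x)"

text \<open>Rows and columns are numbered from 0, so the first elimination step has pivot position 0.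
  The row operation runs over all columns; those to the left of the pivot are
  unaffected, as the pivot row already vanishes there.  If the pivot is 0, where
  elimination without pivoting would break down, then \<open>x / 0 = 0\<close> makes the step the identity.\<close>

definition elim_step :: "nat \<Rightarrow> complex mat \<Rightarrow> complex mat" where
  "elim_step p A = mat (dim_row A) (dim_col A) (\<lambda>(i, j).
     if p < i then A $$ (i, j) - A $$ (i, p) / A $$ (p, p) * A $$ (p, j) else A $$ (i, j))"

primrec gauss_elim :: "complex mat \<Rightarrow> nat \<Rightarrow> complex mat" where
  "gauss_elim A 0 = A"
| "gauss_elim A (Suc k) = elim_step k (gauss_elim A k)"

text \<open>For an \<open>n \<times> n\<close> matrix with \<open>n \<ge> 1\<close> the step number \<open>k < n\<close> ranges over
  \<open>0, \<dots>, n - 1\<close>.  For \<open>n = 0\<close> the maxima are over empty sets and the value is meaningless.\<close>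

definition growth_factor :: "complex mat \<Rightarrow> real" where
  "growth_factor A =
     Max {cmod (gauss_elim A k $$ (i, j)) | i j k. i < dim_row A \<and> j < dim_row A \<and> k < dim_row A}
     / Max {cmod (A $$ (i, j)) | i j. i < dim_row A \<and> j < dim_row A}"

end

theory Submission
  imports Defs
begin

text \<open>
  Write \<open>q\<^sub>M x y = x\<^sup>* M y\<close>.  The proof bounds each entry of \<open>A\<^sup>(\<^sup>k\<^sup>)\<close> by
  \<open>2 \<surd>(\<bar>a\<^sub>i\<^sub>i\<bar> \<bar>a\<^sub>j\<^sub>j\<bar>)\<close>, and rests on two observations.

  Elimination only adds multiples of earlier rows to later ones, so row \<open>i\<close> of \<open>A\<^sup>(\<^sup>k\<^sup>)\<close> is
  \<open>x\<^sup>* A\<close> for some \<open>x\<close> that differs from the unit vector \<open>e\<^sub>i\<close> only in positions below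
  \<open>min i k\<close>; in these positions elimination has made \<open>x\<^sup>* A\<close> vanish.  Hence
  \<open>q\<^sub>A x x = q\<^sub>A x e\<^sub>i\<close>, while the entry in column \<open>j\<close> is \<open>q\<^sub>A x e\<^sub>j\<close>
  (\<open>gauss_elim_row_witness\<close>).

  The second observation is about the form alone.  Measure vectors by the energy
  \<open>N x = q\<^sub>B x x + q\<^sub>C x x\<close>.  The Cauchy--Schwarz inequality for \<open>B\<close> and for \<open>C\<close> gives
  \<open>\<bar>q\<^sub>A x y\<bar>\<^sup>2 \<le> N x N y\<close>, and since \<open>q\<^sub>A x x\<close> lies in the first quadrant,
  \<open>N x \<le> \<surd>2 \<bar>q\<^sub>A x x\<bar>\<close>.  If \<open>q\<^sub>A x x = q\<^sub>A x y\<close>, these combine to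
  \<open>\<bar>q\<^sub>A x x\<bar> \<le> \<surd>2 N y\<close>, so that \<open>N x \<le> 2 N y\<close>; therefore
  \<open>\<bar>q\<^sub>A x z\<bar>\<^sup>2 \<le> 2 N y N z \<le> 4 \<bar>q\<^sub>A y y\<bar> \<bar>q\<^sub>A z z\<bar>\<close> (\<open>orthogonality_entry_bound\<close>).
  With \<open>y = e\<^sub>i\<close> and \<open>z = e\<^sub>j\<close> this is the bound on the entries.
\<close>

section \<open>Sesquilinear forms of complex matrices\<close>

text \<open>Vectors are functions on indices, restricted by the range of summation; this keeps the
  algebra below free of dimension side conditions.\<close>

definition sesq_form :: "complex mat \<Rightarrow> (nat \<Rightarrow> complex) \<Rightarrow> (nat \<Rightarrow> complex) \<Rightarrow> complex" where
  "sesq_form M x y = (\<Sum>i<dim_row M. \<Sum>j<dim_col M. cnj (x i) * M $$ (i, j) * y j)"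

definition unit_fun :: "nat \<Rightarrow> nat \<Rightarrow> complex" where
  "unit_fun j = (\<lambda>i. if i = j then 1 else 0)"

lemma sesq_form_diff_left:
  "sesq_form M (\<lambda>i. x i - c * y i) z = sesq_form M x z - cnj c * sesq_form M y z"
  by (simp add: sesq_form_def algebra_simps sum_subtractf sum_distrib_left)

lemma sesq_form_diff_right:
  "sesq_form M z (\<lambda>i. x i - c * y i) = sesq_form M z x - c * sesq_form M z y"
  by (simp add: sesq_form_def algebra_simps sum_subtractf sum_distrib_left)

lemma sesq_form_unit_right:
  assumes "j < dim_col M"
  shows "sesq_form M x (unit_fun j) = (\<Sum>i<dim_row M. cnj (x i) * M $$ (i, j))"
  using assms by (simp add: sesq_form_def unit_fun_def if_distrib sum.delta cong: if_cong)

lemma sesq_form_unit: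
  assumes "i < dim_row M" "j < dim_col M"
  shows "sesq_form M (unit_fun i) (unit_fun j) = M $$ (i, j)"
proof -
  have "sesq_form M (unit_fun i) (unit_fun j)
      = (\<Sum>l<dim_row M. if l = i then M $$ (l, j) else 0)"
    unfolding sesq_form_unit_right[OF assms(2)] by (intro sum.cong) (auto simp: unit_fun_def)
  then show ?thesis using assms(1) by simp
qed

lemma sesq_form_expand_right:
  "sesq_form M x y = (\<Sum>j<dim_col M. sesq_form M x (unit_fun j) * y j)"
proof -
  have "sesq_form M x y = (\<Sum>j<dim_col M. \<Sum>i<dim_row M. cnj (x i) * M $$ (i, j) * y j)"
    unfolding sesq_form_def by (rule sum.swap)
  also have "\<dots> = (\<Sum>j<dim_col M. sesq_form M x (unit_fun j) * y j)"
    by (intro sum.cong refl) (simp add: sesq_form_unit_right sum_distrib_right)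
  finally show ?thesis .
qed

lemma sesq_form_toeplitz:
  assumes "B \<in> carrier_mat n n" "C \<in> carrier_mat n n"
  shows "sesq_form (B + \<i> \<cdot>\<^sub>m C) x y = sesq_form B x y + \<i> * sesq_form C x y"
  using assms by (simp add: sesq_form_def algebra_simps sum.distrib sum_distrib_left)

section \<open>Positive definite forms\<close>

lemma hermitian_mat_entry:
  assumes "hermitian_mat B" "i < dim_row B" "j < dim_row B"
  shows "B $$ (j, i) = cnj (B $$ (i, j))"
proof -
  have "dim_col B = dim_row B" "mat_adjoint B = B"
    using assms(1) by (auto simp: hermitian_mat_def)
  then show ?thesis
    using assms(2,3) unfolding mat_adjoint_def
    by (metis mat_of_rows_index cols_length length_map nth_map cols_nth conjugate_complex_def
        index_col vec_index_conjugate dim_col)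
qed

lemma hermitian_form_swap:
  assumes "hermitian_mat B"
  shows "sesq_form B y x = cnj (sesq_form B x y)"
proof -
  have sq: "dim_col B = dim_row B" using assms by (simp add: hermitian_mat_def)
  have "sesq_form B y x = (\<Sum>j<dim_row B. \<Sum>i<dim_row B. cnj (y i) * B $$ (i, j) * x j)"
    unfolding sesq_form_def sq by (rule sum.swap)
  also have "\<dots> = cnj (sesq_form B x y)"
    unfolding sesq_form_def sq cnj_sum
    by (intro sum.cong refl) (simp add: hermitian_mat_entry[OF assms, symmetric] mult_ac)
  finally show ?thesis .
qed

lemma pos_def_form_pos:
  assumes "pos_def_mat B" "i < dim_row B" "x i \<noteq> 0"
  shows "0 < sesq_form B x x"
proof -
  let ?n = "dim_row B"
  have sq: "dim_col B = ?n" using assms(1) by (simp add: pos_def_mat_def hermitian_mat_def)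
  have "vec ?n x \<noteq> 0\<^sub>v ?n"
    using assms(2,3) by (metis index_vec index_zero_vec(1))
  then have "0 < (B *\<^sub>v vec ?n x) \<bullet>c vec ?n x"
    using assms(1) by (simp add: pos_def_mat_def)
  also have "(B *\<^sub>v vec ?n x) \<bullet>c vec ?n x = sesq_form B x x"
    using sq
    by (simp add: sesq_form_def scalar_prod_def atLeast0LessThan sum_distrib_left
        sum_distrib_right mult_ac)
  finally show ?thesis .
qed

lemma sesq_form_zero_right:
  assumes "\<And>i. i < dim_col B \<Longrightarrow> y i = 0"
  shows "sesq_form B x y = 0"
  using assms by (simp add: sesq_form_def)

lemma pos_def_form_nonneg:
  assumes "pos_def_mat B"
  shows "0 \<le> sesq_form B x x"
proof (cases "\<exists>i<dim_row B. x i \<noteq> 0")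
  case True
  then show ?thesis using pos_def_form_pos[OF assms] by (auto simp: less_imp_le)
next
  case False
  moreover have "dim_col B = dim_row B"
    using assms by (simp add: pos_def_mat_def hermitian_mat_def)
  ultimately show ?thesis by (simp add: sesq_form_zero_right)
qed

lemma pos_def_form_Cauchy_Schwarz:
  assumes "pos_def_mat B"
  shows "(cmod (sesq_form B x y))\<^sup>2 \<le> Re (sesq_form B x x) * Re (sesq_form B y y)"
proof (cases "\<exists>i<dim_row B. y i \<noteq> 0")
  case False
  moreover have "dim_col B = dim_row B"
    using assms by (simp add: pos_def_mat_def hermitian_mat_def)
  ultimately have "sesq_form B z y = 0" for z by (simp add: sesq_form_zero_right)
  then show ?thesis by simp
next
  case True
  let ?q = "sesq_form B"
  define r where "r = Re (?q y y)"
  have "0 < ?q y y" using True pos_def_form_pos[OF assms] by auto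
  then have r: "?q y y = of_real r" "0 < r"
    by (auto simp: r_def less_complex_def complex_eq_iff)
  have herm: "?q y x = cnj (?q x y)"
    using assms by (intro hermitian_form_swap) (simp add: pos_def_mat_def)
  \<comment> \<open>The projection of \<open>x\<close> onto \<open>y\<close> in the inner product given by \<open>B\<close> is \<open>t y\<close>.\<close>
  define t where "t = cnj (?q x y) / of_real r"
  have "?q (\<lambda>i. x i - t * y i) (\<lambda>i. x i - t * y i)
      = ?q x x - t * ?q x y - cnj t * (?q y x - t * ?q y y)"
    by (simp add: sesq_form_diff_left sesq_form_diff_right)
  also have "\<dots> = ?q x x - ?q x y * cnj (?q x y) / of_real r"
    using r by (simp add: herm t_def)
  also have "\<dots> = ?q x x - of_real ((cmod (?q x y))\<^sup>2 / r)"
    by (simp flip: complex_norm_square)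
  finally have "0 \<le> ?q x x - of_real ((cmod (?q x y))\<^sup>2 / r)"
    by (metis pos_def_form_nonneg[OF assms])
  then have "(cmod (?q x y))\<^sup>2 / r \<le> Re (?q x x)" by (simp add: less_eq_complex_def)
  then show ?thesis using r(2) unfolding r_def[symmetric] by (simp add: divide_le_eq)
qed

section \<open>Forms with positive definite real and imaginary part\<close>

lemma sum_geometric_means_le:
  fixes a b c d :: real
  assumes "0 \<le> a" "0 \<le> b" "0 \<le> c" "0 \<le> d"
  shows "sqrt (a * b) + sqrt (c * d) \<le> sqrt ((a + c) * (b + d))"
proof (rule real_le_rsqrt)
  have "2 * (sqrt (a * d) * sqrt (b * c)) \<le> a * d + b * c"
    using assms sum_squares_bound[of "sqrt (a * d)" "sqrt (b * c)"] by (simp add: mult.assoc)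
  moreover have "sqrt (a * b) * sqrt (c * d) = sqrt (a * d) * sqrt (b * c)"
    by (simp add: real_sqrt_mult)
  ultimately show "(sqrt (a * b) + sqrt (c * d))\<^sup>2 \<le> (a + c) * (b + d)"
    using assms by (simp add: power2_sum algebra_simps)
qed

locale generalized_higham =
  fixes n :: nat and A B C :: "complex mat"
  assumes B_carrier: "B \<in> carrier_mat n n" and C_carrier: "C \<in> carrier_mat n n"
    and B_pos: "pos_def_mat B" and C_pos: "pos_def_mat C"
    and A_def: "A = B + \<i> \<cdot>\<^sub>m C"
begin

lemma dims [simp]: "dim_row A = n" "dim_col A = n"
  using B_carrier C_carrier by (auto simp: A_def)

definition energy :: "(nat \<Rightarrow> complex) \<Rightarrow> real" where
  "energy x = Re (sesq_form B x x) + Re (sesq_form C x x)"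

lemma energy_nonneg: "0 \<le> energy x"
  using pos_def_form_nonneg[OF B_pos, of x] pos_def_form_nonneg[OF C_pos, of x]
  by (simp add: energy_def less_eq_complex_def)

lemma form_split: "sesq_form A x y = sesq_form B x y + \<i> * sesq_form C x y"
  unfolding A_def using B_carrier C_carrier by (rule sesq_form_toeplitz)

lemma form_diag_eq:
  "sesq_form A x x = Complex (Re (sesq_form B x x)) (Re (sesq_form C x x))"
  using pos_def_form_nonneg[OF B_pos, of x] pos_def_form_nonneg[OF C_pos, of x]
  by (simp add: form_split complex_eq_iff less_eq_complex_def)

lemma form_le_energy: "(cmod (sesq_form A x y))\<^sup>2 \<le> energy x * energy y"
proof -
  have nonneg: "0 \<le> Re (sesq_form B z z)" "0 \<le> Re (sesq_form C z z)" for z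
    using pos_def_form_nonneg[OF B_pos, of z] pos_def_form_nonneg[OF C_pos, of z]
    by (simp_all add: less_eq_complex_def)
  have "cmod (sesq_form A x y) \<le> cmod (sesq_form B x y) + cmod (sesq_form C x y)"
    unfolding form_split by (rule norm_triangle_le) (simp add: norm_mult)
  also have "\<dots> \<le> sqrt (Re (sesq_form B x x) * Re (sesq_form B y y))
                + sqrt (Re (sesq_form C x x) * Re (sesq_form C y y))"
    by (intro add_mono real_le_rsqrt pos_def_form_Cauchy_Schwarz B_pos C_pos)
  also have "\<dots> \<le> sqrt (energy x * energy y)"
    unfolding energy_def by (intro sum_geometric_means_le nonneg)
  finally have "(cmod (sesq_form A x y))\<^sup>2 \<le> (sqrt (energy x * energy y))\<^sup>2"
    by (rule power_mono) simp
  then show ?thesis by (simp add: energy_nonneg)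
qed

text \<open>The value \<open>q\<^sub>A x x\<close> lies in the first quadrant, where \<open>Re z + Im z \<le> \<surd>2 \<bar>z\<bar>\<close>.\<close>

lemma energy_le_form: "energy x \<le> sqrt 2 * cmod (sesq_form A x x)"
proof -
  let ?b = "Re (sesq_form B x x)" and ?c = "Re (sesq_form C x x)"
  have "(?b + ?c)\<^sup>2 \<le> 2 * (?b\<^sup>2 + ?c\<^sup>2)"
    using sum_squares_bound[of ?b ?c] by (simp add: power2_sum)
  then have "?b + ?c \<le> sqrt (2 * (?b\<^sup>2 + ?c\<^sup>2))" by (rule real_le_rsqrt)
  then show ?thesis
    by (simp add: energy_def form_diag_eq cmod_def flip: real_sqrt_mult)
qed

text \<open>Since \<open>x\<^sup>* A\<close> annihilates \<open>x - y\<close>, the vector \<open>x\<close> is an oblique projection of \<open>y\<close>.  Unlike an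
  orthogonal projection, it may increase the energy, but only by the factor 2: in
  \<open>\<bar>q\<^sub>A x x\<bar>\<^sup>2 = \<bar>q\<^sub>A x y\<bar>\<^sup>2 \<le> N x N y \<le> \<surd>2 \<bar>q\<^sub>A x x\<bar> N y\<close> one factor cancels.\<close>

lemma orthogonality_energy_bound:
  assumes "sesq_form A x x = sesq_form A x y"
  shows "energy x \<le> 2 * energy y"
proof -
  let ?s = "cmod (sesq_form A x x)"
  have "?s * ?s \<le> energy x * energy y"
    using form_le_energy[of x y] assms by (simp add: power2_eq_square)
  also have "\<dots> \<le> (sqrt 2 * ?s) * energy y"
    by (intro mult_right_mono energy_le_form energy_nonneg)
  finally have "?s * ?s \<le> ?s * (sqrt 2 * energy y)" by (simp add: mult_ac)
  then have s: "?s \<le> sqrt 2 * energy y"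
    using energy_nonneg[of y] by (cases "?s = 0") (auto simp: mult_le_cancel_left)
  have "energy x \<le> sqrt 2 * ?s" by (rule energy_le_form)
  also have "\<dots> \<le> sqrt 2 * (sqrt 2 * energy y)" using s by (intro mult_left_mono) auto
  finally show ?thesis by (simp flip: mult.assoc)
qed

lemma orthogonality_entry_bound:
  assumes "sesq_form A x x = sesq_form A x y"
  shows "(cmod (sesq_form A x z))\<^sup>2 \<le> 4 * cmod (sesq_form A y y) * cmod (sesq_form A z z)"
proof -
  have "(cmod (sesq_form A x z))\<^sup>2 \<le> energy x * energy z" by (rule form_le_energy)
  also have "\<dots> \<le> 2 * energy y * energy z"
    using orthogonality_energy_bound[OF assms] by (intro mult_right_mono energy_nonneg)
  also have "\<dots> \<le> 2 * (sqrt 2 * cmod (sesq_form A y y)) * (sqrt 2 * cmod (sesq_form A z z))"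
    by (intro mult_mono energy_le_form) (auto simp: energy_nonneg)
  also have "\<dots> = 2 * (sqrt 2 * sqrt 2) * cmod (sesq_form A y y) * cmod (sesq_form A z z)"
    by (simp only: mult_ac)
  finally show ?thesis by simp
qed

lemma form_diag_nonzero:
  assumes "i < n" "x i \<noteq> 0"
  shows "sesq_form A x x \<noteq> 0"
  using pos_def_form_pos[OF B_pos, of i x] B_carrier assms
  by (auto simp: form_diag_eq complex_eq_iff less_complex_def)

section \<open>Gaussian elimination\<close>

text \<open>The row operations applied to row \<open>i\<close> so far are collected in \<open>x\<close>.  Complementary positions in
  the first and third clause make \<open>x\<^sup>* A (x - e\<^sub>i)\<close> vanish term by term.\<close>

definition row_witness :: "nat \<Rightarrow> nat \<Rightarrow> (nat \<Rightarrow> complex) \<Rightarrow> bool" where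
  "row_witness k i x \<longleftrightarrow>
     (\<forall>j. \<not> j < min i k \<longrightarrow> x j = unit_fun i j) \<and>
     (\<forall>j<n. gauss_elim A k $$ (i, j) = sesq_form A x (unit_fun j)) \<and>
     (\<forall>j<min i k. sesq_form A x (unit_fun j) = 0)"

lemma row_witness_orthogonality:
  assumes "row_witness k i x" "i < n"
  shows "sesq_form A x x = sesq_form A x (unit_fun i)"
proof -
  have "sesq_form A x (unit_fun j) * x j = sesq_form A x (unit_fun j) * unit_fun i j" for j
    using assms(1) by (cases "j < min i k") (auto simp: row_witness_def)
  then have "(\<Sum>j<n. sesq_form A x (unit_fun j) * x j)
      = (\<Sum>j<n. sesq_form A x (unit_fun j) * unit_fun i j)"
    by (rule sum.cong[OF refl])
  then show ?thesis
    using sesq_form_expand_right[of A x x] sesq_form_expand_right[of A x "unit_fun i"] by simp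
qed

lemma dim_gauss_elim [simp]:
  "dim_row (gauss_elim M k) = dim_row M" "dim_col (gauss_elim M k) = dim_col M"
  by (induction k) (simp_all add: elim_step_def)

text \<open>Pivots are nonzero because the pivot in row \<open>k\<close> is \<open>q\<^sub>A y y\<close> for the witness \<open>y\<close> of that
  row, whose component \<open>k\<close> is 1.\<close>

lemma gauss_elim_row_witness:
  assumes "i < n"
  shows "\<exists>x. row_witness k i x"
  using assms
proof (induction k arbitrary: i)
  case 0
  then have "row_witness 0 i (unit_fun i)"
    by (simp add: row_witness_def sesq_form_unit)
  then show ?case by blast
next
  case (Suc k)
  obtain x where x: "row_witness k i x" using Suc by blast
  show ?case
  proof (cases "k < i")
    case False
    then have "row_witness (Suc k) i x"
      using x Suc.prems by (auto simp: row_witness_def elim_step_def)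
    then show ?thesis by blast
  next
    case True
    then have "k < n" using Suc.prems by simp
    then obtain y where y: "row_witness k k y" using Suc.IH by blast
    let ?G = "gauss_elim A k"
    define m where "m = ?G $$ (i, k) / ?G $$ (k, k)"
    define z where "z = (\<lambda>l. x l - cnj m * y l)"
    have "y k = 1" using y by (simp add: row_witness_def unit_fun_def)
    then have "sesq_form A y y \<noteq> 0" using \<open>k < n\<close> by (intro form_diag_nonzero[of k]) auto
    then have pivot: "sesq_form A y (unit_fun k) \<noteq> 0"
      using row_witness_orthogonality[OF y \<open>k < n\<close>] by simp
    have form_z: "sesq_form A z (unit_fun j)
        = sesq_form A x (unit_fun j) - m * sesq_form A y (unit_fun j)" for j
      by (simp add: z_def sesq_form_diff_left)
    have "row_witness (Suc k) i z"
      unfolding row_witness_def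
    proof (intro conjI allI impI)
      fix j assume "\<not> j < min i (Suc k)"
      then show "z j = unit_fun i j"
        using x y True by (simp add: z_def row_witness_def unit_fun_def)
    next
      fix j assume "j < n"
      then show "gauss_elim A (Suc k) $$ (i, j) = sesq_form A z (unit_fun j)"
        using x y True Suc.prems \<open>k < n\<close>
        by (simp add: elim_step_def form_z row_witness_def m_def)
    next
      fix j assume j: "j < min i (Suc k)"
      show "sesq_form A z (unit_fun j) = 0"
      proof (cases "j = k")
        case True
        then show ?thesis
          using x y pivot \<open>k < n\<close> by (simp add: form_z m_def row_witness_def)
      next
        case False
        then show ?thesis using x y j by (simp add: form_z row_witness_def)
      qed
    qed
    then show ?thesis by blast
  qed
qed

theorem gauss_elim_entry_bound:
  assumes "i < n" "j < n"
  shows "(cmod (gauss_elim A k $$ (i, j)))\<^sup>2 \<le> 4 * cmod (A $$ (i, i)) * cmod (A $$ (j, j))"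
proof -
  obtain x where x: "row_witness k i x" using gauss_elim_row_witness assms(1) by blast
  have "sesq_form A x x = sesq_form A x (unit_fun i)"
    using x assms(1) by (rule row_witness_orthogonality)
  from orthogonality_entry_bound[OF this, of "unit_fun j"] show ?thesis
    using x assms by (simp add: row_witness_def sesq_form_unit)
qed

end

theorem corollary2p3:
  fixes n :: nat and A B C :: "complex mat"
  assumes "n \<ge> 1"
    and "B \<in> carrier_mat n n" and "C \<in> carrier_mat n n"
    and "pos_def_mat B" and "pos_def_mat C"
    and "A = B + \<i> \<cdot>\<^sub>m C"
  shows "0 \<le> growth_factor A \<and> growth_factor A \<le> 2"
proof -
  interpret generalized_higham n A B C using assms by unfold_locales
  define S where "S = {cmod (A $$ (i, j)) | i j. i < n \<and> j < n}"
  define T where "T = {cmod (gauss_elim A k $$ (i, j)) | i j k. i < n \<and> j < n \<and> k < n}"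
  have "S = (\<lambda>(i, j). cmod (A $$ (i, j))) ` ({..<n} \<times> {..<n})"
    by (auto simp: S_def)
  then have finS: "finite S" by simp
  have "T = (\<lambda>(i, j, k). cmod (gauss_elim A k $$ (i, j))) ` ({..<n} \<times> {..<n} \<times> {..<n})"
    by (force simp: T_def)
  then have finT: "finite T" by simp
  have A_le: "cmod (A $$ (i, j)) \<le> Max S" if "i < n" "j < n" for i j
    using that finS by (intro Max_ge) (auto simp: S_def)
  have S0: "0 \<le> Max S" using A_le[of 0 0] assms(1) by (simp add: order_trans[OF norm_ge_zero])
  have "cmod (gauss_elim A 0 $$ (0, 0)) \<in> T" using assms(1) unfolding T_def
    by (intro CollectI exI[of _ 0]) simp
  then have T_ne: "T \<noteq> {}" and T0: "0 \<le> Max T"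
    using order_trans[OF norm_ge_zero Max_ge[OF finT]] by auto
  have "cmod (gauss_elim A k $$ (i, j)) \<le> 2 * Max S" if "i < n" "j < n" for i j k
  proof (rule power2_le_imp_le)
    have "(cmod (gauss_elim A k $$ (i, j)))\<^sup>2 \<le> 4 * (cmod (A $$ (i, i)) * cmod (A $$ (j, j)))"
      using gauss_elim_entry_bound[OF that, of k] by simp
    also have "\<dots> \<le> 4 * (Max S * Max S)"
      using that S0 by (intro mult_left_mono mult_mono A_le) auto
    finally show "(cmod (gauss_elim A k $$ (i, j)))\<^sup>2 \<le> (2 * Max S)\<^sup>2"
      by (simp add: power2_eq_square)
  qed (use S0 in simp)
  then have "Max T \<le> 2 * Max S"
    using finT T_ne by (auto simp: T_def)
  moreover have "growth_factor A = Max T / Max S"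
    by (simp add: growth_factor_def S_def T_def)
  \<comment> \<open>If \<open>Max S = 0\<close>, the quotient is 0 by convention, within the bounds.\<close>
  ultimately show ?thesis
    using S0 T0 by (cases "Max S = 0") (simp_all add: divide_le_eq)
qed

end
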